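(* Assume that $f:\mathbb{R}^n\to\overline{\mathbb{R}}$ is twice continuously differentiable around some $\bar x\in\mathbb{R}^n$ with $\nabla f(\bar x)=0$ and $\nabla^2f(\bar x)$ nonsingular. The following hold: (a) If $\nabla^2f(\bar x)$ is negative definite, then $f$ satisfies the KL property at $\bar x$ with exponent $0$, which is not sharp, as $\partial^{>}f(\bar x)=\emptyset$. (b) If $\nabla^2f(\bar x)$ is positive definite or indefinite, then $f$ satisfies the KL property at $\bar x$ with a sharp exponent of $\frac12$. Moreover, $\mathrm{KL}(f,\bar x,\frac12)=\sqrt{\frac{\lambda_{\min}}{2}}$, where $\lambda_{\min}$ is the smallest positive eigenvalue of $\nabla^2f(\bar x)$. In this case, $$\partial^{>}g(\bar x)=\left\{\frac{\sqrt2}{2}\frac{\nabla^2f(\bar x)w}{\sqrt{w^T\nabla^2f(\bar x)w}}\ \Big|\ w^T\nabla^2f(\bar x)w>0\right\},$$ where $g(x):=\sqrt{\max\{f(x)-f(\bar x),0\}}$.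
   Context: $\overline{\mathbb{R}}=\mathbb{R}\cup\{\pm\infty\}$. $d(v,A)=\inf_{a\in A}\|a-v\|$, with $d(v,\emptyset)=+\infty$. Subgradients. Let $\varphi(x)$ be finite. $v\in\widehat\partial\varphi(x)$ if $\varphi(y)\ge\varphi(x)+\langle v,y-x\rangle+o(\|y-x\|)$. $v\in\partial\varphi(x)$ (limiting) if there are $x_k\to x$, $v_k\to v$ with $\varphi(x_k)\to\varphi(x)$ and $v_k\in\widehat\partial\varphi(x_k)$. $v\in\partial^{>}\varphi(x)$ (outer limiting) if there are $x_k\to x$, $v_k\to v$ with $\varphi(x_k)\to\varphi(x)$, $\varphi(x_k)>\varphi(x)$ and $v_k\in\partial\varphi(x_k)$. KL property. $f$ satisfies the KL property at $\bar x$ with exponent $\theta\in[0,1)$ if there exist $\mu>0$ (modulus), $\epsilon>0$, $\nu\in(0,+\infty]$ such that $d(0,\partial f(x))\ge\frac{\mu}{1-\theta}(f(x)-f(\bar x))^{\theta}$ whenever $\|x-\bar x\|\le\epsilon$ and $f(\bar x)<f(x)<f(\bar x)+\nu$. $\mathrm{KL}(f,\bar x,\theta)$ is the supremum of all such $\mu$ ($\sup\emptyset:=0$); equivalently the liminf of $\frac{(1-\theta)d(0,\partial f(x))}{(f(x)-f(\bar x))^{\theta}}$ as $x\to\bar x$, $f(x)\to f(\bar x)$, $f(x)>f(\bar x)$ ($+\infty$ if there are no such sequences). An exponent $\theta\in(0,1)$ is sharp if $f$ satisfies the KL property at $\bar x$ with exponent $\theta$ but not with any exponent $\theta'\in[0,\theta)$.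 The exponent $0$ is sharp if $f$ satisfies the KL property at $\bar x$ with exponent $0$ and $\partial^{>}f(\bar x)\neq\emptyset$. *)

theory Defs
  imports "HOL-Analysis.Analysis" "HOL-Library.Landau_Symbols"
begin

section \<open>Distance and subgradients\<close>

text \<open>In \<^typ>\<open>ereal\<close> the infimum over the empty set is \<open>\<infinity>\<close>, so \<open>edist v {} = \<infinity>\<close>
  (unlike \<^const>\<open>infdist\<close>).\<close>

definition edist :: "'a::real_normed_vector \<Rightarrow> 'a set \<Rightarrow> ereal" where
  "edist v A = (INF a\<in>A. ereal (norm (a - v)))"

text \<open>All three subdifferentials are empty at points where the function is not finite.\<close>

definition regular_subdiff :: "('a::euclidean_space \<Rightarrow> ereal) \<Rightarrow> 'a \<Rightarrow> 'a set" where
  "regular_subdiff \<phi> x =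
     {v. \<bar>\<phi> x\<bar> \<noteq> \<infinity> \<and>
         (\<exists>r :: 'a \<Rightarrow> real. r \<in> o[at x](\<lambda>y. norm (y - x)) \<and>
            (\<forall>\<^sub>F y in at x. \<phi> y \<ge> \<phi> x + ereal (v \<bullet> (y - x) + r y)))}"

definition limiting_subdiff :: "('a::euclidean_space \<Rightarrow> ereal) \<Rightarrow> 'a \<Rightarrow> 'a set" where
  "limiting_subdiff \<phi> x =
     {v. \<bar>\<phi> x\<bar> \<noteq> \<infinity> \<and>
         (\<exists>X V :: nat \<Rightarrow> 'a. X \<longlonglongrightarrow> x \<and> V \<longlonglongrightarrow> v \<and>
            (\<lambda>k. \<phi> (X k)) \<longlonglongrightarrow> \<phi> x \<and> (\<forall>k. V k \<in> regular_subdiff \<phi> (X k)))}"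

definition outer_limiting_subdiff :: "('a::euclidean_space \<Rightarrow> ereal) \<Rightarrow> 'a \<Rightarrow> 'a set" where
  "outer_limiting_subdiff \<phi> x =
     {v. \<bar>\<phi> x\<bar> \<noteq> \<infinity> \<and>
         (\<exists>X V :: nat \<Rightarrow> 'a. X \<longlonglongrightarrow> x \<and> V \<longlonglongrightarrow> v \<and>
            (\<lambda>k. \<phi> (X k)) \<longlonglongrightarrow> \<phi> x \<and> (\<forall>k. \<phi> (X k) > \<phi> x) \<and>
            (\<forall>k. V k \<in> limiting_subdiff \<phi> (X k)))}"

section \<open>The Kurdyka--Lojasiewicz property\<close>

text \<open>The power is only ever taken of a positive finite number, where
  \<^const>\<open>powr\<close> satisfies \<open>t powr 0 = 1\<close>.\<close>

definition KL_modulus ::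
    "('a::euclidean_space \<Rightarrow> ereal) \<Rightarrow> 'a \<Rightarrow> real \<Rightarrow> real \<Rightarrow> bool" where
  "KL_modulus f xb \<theta> \<mu> \<longleftrightarrow>
     \<bar>f xb\<bar> \<noteq> \<infinity> \<and> 0 \<le> \<theta> \<and> \<theta> < 1 \<and> \<mu> > 0 \<and>
     (\<exists>\<epsilon>::real. \<epsilon> > 0 \<and> (\<exists>\<nu>::ereal. \<nu> > 0 \<and>
        (\<forall>x. norm (x - xb) \<le> \<epsilon> \<and> f xb < f x \<and> f x < f xb + \<nu> \<longrightarrow>
           edist 0 (limiting_subdiff f x)
             \<ge> ereal (\<mu> / (1 - \<theta>) * real_of_ereal (f x - f xb) powr \<theta>))))"

definition KL_property :: "('a::euclidean_space \<Rightarrow> ereal) \<Rightarrow> 'a \<Rightarrow> real \<Rightarrow> bool" where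
  "KL_property f xb \<theta> \<longleftrightarrow> (\<exists>\<mu>. KL_modulus f xb \<theta> \<mu>)"

text \<open>Moduli are positive, so inserting 0 only implements the convention \<open>sup {} = 0\<close>.\<close>

definition KL :: "('a::euclidean_space \<Rightarrow> ereal) \<Rightarrow> 'a \<Rightarrow> real \<Rightarrow> ereal" where
  "KL f xb \<theta> = Sup (insert 0 {ereal \<mu> | \<mu>. KL_modulus f xb \<theta> \<mu>})"

definition sharp_KL_exponent :: "('a::euclidean_space \<Rightarrow> ereal) \<Rightarrow> 'a \<Rightarrow> real \<Rightarrow> bool" where
  "sharp_KL_exponent f xb \<theta> \<longleftrightarrow>
     KL_property f xb \<theta> \<and>
     (if \<theta> = 0 then outer_limiting_subdiff f xb \<noteq> {}
      else (\<forall>\<theta>'. 0 \<le> \<theta>' \<and> \<theta>' < \<theta> \<longrightarrow> \<not> KL_property f xb \<theta>'))"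

section \<open>Gradient and Hessian of extended-real-valued functions\<close>

text \<open>These are meaningful only at points around which \<open>f\<close> is finite and (twice)
  differentiable, which \<open>C2_around\<close> below guarantees.\<close>

definition grad :: "(real^'n \<Rightarrow> ereal) \<Rightarrow> real^'n \<Rightarrow> real^'n" where
  "grad f x = (THE v. GDERIV (\<lambda>y. real_of_ereal (f y)) x :> v)"

definition hessian :: "(real^'n \<Rightarrow> ereal) \<Rightarrow> real^'n \<Rightarrow> real^'n^'n" where
  "hessian f x = jacobian (grad f) (at x)"

definition C2_around :: "(real^'n \<Rightarrow> ereal) \<Rightarrow> real^'n \<Rightarrow> bool" where
  "C2_around f xb \<longleftrightarrow>
     (\<exists>U. open U \<and> xb \<in> U \<and>
        (\<forall>x\<in>U. \<bar>f x\<bar> \<noteq> \<infinity>) \<and>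
        (\<forall>x\<in>U. (\<lambda>y. real_of_ereal (f y)) differentiable (at x)) \<and>
        (\<forall>x\<in>U. grad f differentiable (at x)) \<and>
        continuous_on U (hessian f))"

section \<open>Definiteness and eigenvalues of real matrices\<close>

text \<open>The definiteness notions refer to the quadratic form; they are applied to Hessians of
  twice continuously differentiable functions, which are symmetric.\<close>

definition positive_definite :: "real^'n^'n \<Rightarrow> bool" where
  "positive_definite A \<longleftrightarrow> (\<forall>w. w \<noteq> 0 \<longrightarrow> w \<bullet> (A *v w) > 0)"

definition negative_definite :: "real^'n^'n \<Rightarrow> bool" where
  "negative_definite A \<longleftrightarrow> (\<forall>w. w \<noteq> 0 \<longrightarrow> w \<bullet> (A *v w) < 0)"

definition indefinite :: "real^'n^'n \<Rightarrow> bool" where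
  "indefinite A \<longleftrightarrow> (\<exists>w. w \<bullet> (A *v w) > 0) \<and> (\<exists>w. w \<bullet> (A *v w) < 0)"

definition eigenvalue :: "real^'n^'n \<Rightarrow> real \<Rightarrow> bool" where
  "eigenvalue A c \<longleftrightarrow> (\<exists>v. v \<noteq> 0 \<and> A *v v = c *\<^sub>R v)"

definition least_pos_eigenvalue :: "real^'n^'n \<Rightarrow> real" where
  "least_pos_eigenvalue A = (LEAST c. c > 0 \<and> eigenvalue A c)"

section \<open>Extended square root\<close>

text \<open>Only used at nonnegative arguments; the value at \<open>-\<infinity>\<close> is a dummy.\<close>

definition esqrt :: "ereal \<Rightarrow> ereal" where
  "esqrt x = (if x = \<infinity> then \<infinity> else ereal (sqrt (real_of_ereal x)))"

end

theory Submission
  imports Defs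
begin

text \<open>
  Write \<open>F\<close> for the finite part of \<open>f\<close> near \<open>xb\<close>, \<open>G\<close> for its gradient and \<open>A\<close> for the derivative of
  \<open>G\<close> at \<open>xb\<close>. The idea is to blow up at the critical point: if points \<open>X k\<close> tend to \<open>xb\<close> and their
  displacements, divided by scales \<open>s k\<close>, tend to \<open>u\<close>, then \<open>G (X k)\<close> divided by \<open>s k\<close> tends to
  \<open>A u\<close>, and \<open>F (X k) - F xb\<close> divided by the square of \<open>s k\<close> tends to \<open>u \<bullet> A u / 2\<close> (\<open>blow_up\<close>).
  So every quantity in the theorem is read off from the quadratic form of \<open>A\<close>, because near \<open>xb\<close> the
  limiting subdifferential of \<open>f\<close> is \<open>{G x}\<close>.

  There are two sources of sequences. From any sequence with \<open>f (X k) > f xb\<close> compactness of the unit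
  sphere extracts a unit limit direction \<open>u\<close>, and it has \<open>u \<bullet> A u \<ge> 0\<close> (\<open>ascent_subsequence\<close>).
  Conversely, every \<open>w\<close> with \<open>w \<bullet> A w > 0\<close> is the direction of such a sequence (\<open>ascent_path\<close>).

  If \<open>A\<close> is negative definite, no sequence of the first kind exists: \<open>f\<close> has a local maximum at \<open>xb\<close>, so
  the inequality for exponent 0 is vacuous and the outer limiting subdifferential is empty.

  Otherwise some \<open>w \<bullet> A w\<close> is positive, and the smallest positive eigenvalue \<open>l\<close> is the largest constant
  with \<open>l * (w \<bullet> A w) \<le> (norm (A w))\<^sup>2\<close> for all \<open>w\<close> (\<open>least_positive_eigenvalue_variational\<close>). A modulus
  \<open>\<mu>\<close> with \<open>2 * \<mu>\<^sup>2 < l\<close> works for the exponent 1/2: a sequence of violations would have a limit direction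
  violating this inequality (\<open>KL_modulus_half\<close>). Along an eigenvector for \<open>l\<close> the blow-up forces
  \<open>2 * \<mu>\<^sup>2 \<le> l\<close>, and forces \<open>\<mu> \<le> 0\<close> when the exponent is below 1/2 (\<open>KL_modulus_bound\<close>).
  Finally, above the level of \<open>xb\<close> the function \<open>g\<close> has gradient \<open>G x / (2 * sqrt (F x - F xb))\<close>;
  the scales cancel in this quotient, so its limits are exactly \<open>A u / (2 * sqrt (u \<bullet> A u / 2))\<close> with
  \<open>u \<bullet> A u > 0\<close>. Here \<open>u \<bullet> A u = 0\<close> is impossible since \<open>A u \<noteq> 0\<close> would make the quotient unbounded.
\<close>

section \<open>Gradients and subdifferentials of smooth functions\<close>


lemma gderiv_exists:
  fixes F :: "'a::euclidean_space \<Rightarrow> real"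
  assumes "F differentiable (at x)"
  shows "\<exists>v. GDERIV F x :> v"
proof -
  obtain D where D: "(F has_derivative D) (at x)"
    using assms by (auto simp: differentiable_def)
  have "D = (\<lambda>h. h \<bullet> adjoint D 1)"
    using adjoint_works[OF has_derivative_linear[OF D]] by (auto simp: fun_eq_iff)
  with D show ?thesis
    unfolding gderiv_def by metis
qed

lemma gderiv_unique:
  assumes "GDERIV F x :> v" and "GDERIV F x :> w"
  shows "v = w"
  using has_derivative_unique[OF assms[unfolded gderiv_def]]
  by (metis vector_eq_ldot)

lemma gderiv_grad:
  assumes "(\<lambda>y. real_of_ereal (f y)) differentiable (at x)"
  shows "GDERIV (\<lambda>y. real_of_ereal (f y)) x :> grad f x"
proof -
  obtain v where v: "GDERIV (\<lambda>y. real_of_ereal (f y)) x :> v"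
    using gderiv_exists[OF assms] by blast
  show ?thesis
    unfolding grad_def by (rule theI[of _ v]) (use v gderiv_unique in blast)+
qed

lemma gderiv_little_o:
  fixes F :: "'a::euclidean_space \<Rightarrow> real"
  assumes "GDERIV F x :> v"
  shows "(\<lambda>y. F y - F x - v \<bullet> (y - x)) \<in> o[at x](\<lambda>y. norm (y - x))"
proof (rule smalloI_tendsto)
  show "((\<lambda>y. (F y - F x - v \<bullet> (y - x)) / norm (y - x)) \<longlongrightarrow> 0) (at x)"
  proof (rule tendsto_norm_zero_cancel)
    have "((\<lambda>y. norm (F y - F x - (y - x) \<bullet> v) / norm (y - x)) \<longlongrightarrow> 0) (at x)"
      using assms unfolding gderiv_def has_derivative_iff_norm by blast
    then show "((\<lambda>y. norm ((F y - F x - v \<bullet> (y - x)) / norm (y - x))) \<longlongrightarrow> 0) (at x)"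
      by (simp add: inner_commute[of _ v])
  qed
  show "\<forall>\<^sub>F y in at x. norm (y - x) \<noteq> 0"
    by (simp add: eventually_at_filter)
qed

text \<open>For a regular subgradient \<open>v\<close>, put \<open>e = d - v\<close>. Moving from \<open>x\<close> in the direction \<open>- e\<close> would decrease
  \<open>\<phi>\<close> below the linear minorant at the rate \<open>norm e\<close>, unless \<open>e = 0\<close>.\<close>
lemma regular_subdiff_smooth:
  fixes \<phi> :: "'a::euclidean_space \<Rightarrow> ereal"
  assumes W: "open W" "x \<in> W" and eq: "\<And>y. y \<in> W \<Longrightarrow> \<phi> y = ereal (F y)"
    and F: "GDERIV F x :> d"
  shows "regular_subdiff \<phi> x = {d}"
proof (intro equalityI subsetI)
  have near: "\<forall>\<^sub>F y in at x. y \<in> W"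
    using W by (auto simp: eventually_at_topological)
  have "\<forall>\<^sub>F y in at x. \<phi> y \<ge> \<phi> x + ereal (d \<bullet> (y - x) + (F y - F x - d \<bullet> (y - x)))"
    using near by eventually_elim (simp add: eq W)
  moreover have "\<bar>\<phi> x\<bar> \<noteq> \<infinity>"
    by (simp add: eq W)
  ultimately have "d \<in> regular_subdiff \<phi> x"
    unfolding regular_subdiff_def
    by (intro CollectI conjI exI[of _ "\<lambda>y. F y - F x - d \<bullet> (y - x)"] gderiv_little_o[OF F])
  then show "v \<in> regular_subdiff \<phi> x" if "v \<in> {d}" for v
    using that by simp

  fix v assume "v \<in> regular_subdiff \<phi> x"
  then obtain r where r: "r \<in> o[at x](\<lambda>y. norm (y - x))"
    and ev: "\<forall>\<^sub>F y in at x. \<phi> y \<ge> \<phi> x + ereal (v \<bullet> (y - x) + r y)"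
    unfolding regular_subdiff_def by auto
  have ev': "\<forall>\<^sub>F y in at x. F y - F x - v \<bullet> (y - x) - r y \<ge> 0"
    using ev near by eventually_elim (simp add: eq W)
  define e where "e = d - v"
  have lim: "((\<lambda>y. (F y - F x - d \<bullet> (y - x)) / norm (y - x) - r y / norm (y - x)) \<longlongrightarrow> 0 - 0) (at x)"
    using tendsto_diff[OF smalloD_tendsto[OF gderiv_little_o[OF F]] smalloD_tendsto[OF r]] .
  have norm_e: "norm e * norm e = d \<bullet> e - v \<bullet> e"
    using power2_norm_eq_inner[of e] by (simp add: power2_eq_square e_def inner_diff_left)
  have "e = 0"
  proof (rule ccontr)
    assume "e \<noteq> 0"
    have quot: "a \<le> N / (t * a)" if "t * (a * a) \<le> N" "t > 0" "a > 0" for a t N :: real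
      using that by (simp add: pos_le_divide_eq mult_ac)
    \<comment> \<open>Approaching \<open>x\<close> along this ray, the remainder quotient with limit 0 stays above \<open>norm e\<close>.\<close>
    have path: "filterlim (\<lambda>t::real. x - t *\<^sub>R e) (at x) (at_right 0)"
    proof (rule filterlim_atI)
      have "((\<lambda>t. x - t *\<^sub>R e) \<longlongrightarrow> x - 0 *\<^sub>R e) (at_right 0)"
        by (intro tendsto_intros)
      then show "((\<lambda>t. x - t *\<^sub>R e) \<longlongrightarrow> x) (at_right 0)"
        by simp
      show "\<forall>\<^sub>F t in at_right 0. x - t *\<^sub>R e \<noteq> x"
        using \<open>e \<noteq> 0\<close> by (auto simp: eventually_at_filter)
    qed
    have lim': "((\<lambda>t. (F (x - t *\<^sub>R e) - F x - d \<bullet> (x - t *\<^sub>R e - x)) / norm (x - t *\<^sub>R e - x)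
        - r (x - t *\<^sub>R e) / norm (x - t *\<^sub>R e - x)) \<longlongrightarrow> 0) (at_right 0)"
      using filterlim_compose[OF lim path] by simp
    have "\<forall>\<^sub>F t in at_right 0. (F (x - t *\<^sub>R e) - F x - d \<bullet> (x - t *\<^sub>R e - x)) / norm (x - t *\<^sub>R e - x)
        - r (x - t *\<^sub>R e) / norm (x - t *\<^sub>R e - x) \<ge> norm e"
      using eventually_compose_filterlim[OF ev' path] eventually_at_right_less[of "0::real"]
    proof eventually_elim
      case (elim t)
      have le: "t * (norm e * norm e) \<le> F (x - t *\<^sub>R e) - F x - d \<bullet> (x - t *\<^sub>R e - x) - r (x - t *\<^sub>R e)"
        using elim(1) unfolding norm_e by (simp add: right_diff_distrib)
      have nrm: "norm (x - t *\<^sub>R e - x) = t * norm e"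
        using elim(2) by simp
      show ?case
        unfolding nrm diff_divide_distrib[symmetric]
        by (rule quot[OF le elim(2)]) (use \<open>e \<noteq> 0\<close> in simp)
    qed
    from tendsto_lowerbound[OF lim' this] \<open>e \<noteq> 0\<close> show False by simp
  qed
  then show "v \<in> {d}" by (simp add: e_def)
qed

text \<open>The regular subgradients at nearby points are the gradients there, and these converge to \<open>D x\<close>.
  Continuity of \<open>D\<close> cannot be dropped: otherwise limits of nearby gradients could differ from \<open>D x\<close>.\<close>
lemma limiting_subdiff_smooth:
  fixes \<phi> :: "'a::euclidean_space \<Rightarrow> ereal"
  assumes W: "open W" "x \<in> W" and eq: "\<And>y. y \<in> W \<Longrightarrow> \<phi> y = ereal (F y)"
    and F: "\<And>y. y \<in> W \<Longrightarrow> GDERIV F y :> D y"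
    and D: "continuous_on W D"
  shows "limiting_subdiff \<phi> x = {D x}"
proof (intro equalityI subsetI)
  have reg: "regular_subdiff \<phi> y = {D y}" if "y \<in> W" for y
    using regular_subdiff_smooth[OF W(1) that eq F[OF that]] by simp
  fix v assume "v \<in> limiting_subdiff \<phi> x"
  then obtain X V where X: "X \<longlonglongrightarrow> x" and V: "V \<longlonglongrightarrow> v"
    and mem: "\<And>k. V k \<in> regular_subdiff \<phi> (X k)"
    unfolding limiting_subdiff_def by blast
  have "\<forall>\<^sub>F k in sequentially. X k \<in> W"
    using X W by (rule topological_tendstoD)
  then have "\<forall>\<^sub>F k in sequentially. D (X k) = V k"
    by eventually_elim (metis mem reg singletonD)
  moreover have "(\<lambda>k. D (X k)) \<longlonglongrightarrow> D x"
    using D W by (intro isCont_tendsto_compose[OF _ X]) (simp add: continuous_on_eq_continuous_at)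
  ultimately have "V \<longlonglongrightarrow> D x"
    using tendsto_cong by force
  with V show "v \<in> {D x}"
    by (simp add: LIMSEQ_unique)
next
  fix v assume "v \<in> {D x}"
  then have "v \<in> regular_subdiff \<phi> x"
    using regular_subdiff_smooth[OF W eq F[OF W(2)]] by simp
  then show "v \<in> limiting_subdiff \<phi> x"
    unfolding limiting_subdiff_def using eq[OF W(2)]
    by (intro CollectI conjI exI[of _ "\<lambda>_. x"] exI[of _ "\<lambda>_. v"]) auto
qed

lemma edist_zero_singleton: "edist 0 {v} = ereal (norm v)"
  by (simp add: edist_def)

section \<open>The smallest positive eigenvalue of a symmetric operator\<close>

lemma nonneg_quadratic_linear_coeff:
  fixes b c :: real
  assumes "\<And>t. t * b + t\<^sup>2 * c \<ge> 0"
  shows "b = 0"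
proof (rule ccontr)
  assume "b \<noteq> 0"
  define a where "a = \<bar>c\<bar> + 1"
  have a: "a > 0" "c < a"
    by (auto simp: a_def)
  have "(- b / a) * b + (- b / a)\<^sup>2 * c = b\<^sup>2 * (c - a) / a\<^sup>2"
    using a(1) by (simp add: power2_eq_square field_simps)
  also have "\<dots> < 0"
    using \<open>b \<noteq> 0\<close> a by (intro divide_neg_pos mult_pos_neg) auto
  finally show False
    using assms[of "- b / a"] by simp
qed

text \<open>The quotient \<open>(w \<bullet> A w) / (norm (A w))\<^sup>2\<close> does not change under scaling, so it attains its maximum \<open>m\<close> on
  the unit sphere, say at \<open>v\<close>. Then the nonnegative form \<open>m * (norm (A w))\<^sup>2 - w \<bullet> A w\<close> vanishes at \<open>v\<close>, hence
  so does its gradient \<open>2 *\<^sub>R A (m *\<^sub>R A v - v)\<close>, and injectivity gives \<open>A v = (1 / m) *\<^sub>R v\<close>.\<close>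
lemma least_positive_eigenvalue_variational:
  fixes A :: "'a::euclidean_space \<Rightarrow> 'a"
  assumes lin: "linear A" and sym: "\<And>u v. u \<bullet> A v = A u \<bullet> v"
    and inj: "\<And>v. A v = 0 \<Longrightarrow> v = 0" and pos: "w0 \<bullet> A w0 > 0"
  obtains l v where "l > 0" "v \<noteq> 0" "A v = l *\<^sub>R v" "\<And>w. l * (w \<bullet> A w) \<le> (norm (A w))\<^sup>2"
proof -
  interpret linear A by fact
  define R where "R w = (w \<bullet> A w) / (norm (A w))\<^sup>2" for w
  have contA: "continuous_on S A" for S
    using lin by (simp add: linear_continuous_on linear_conv_bounded_linear)
  have "continuous_on (sphere 0 1) R"
    unfolding R_def by (intro continuous_intros contA) (use inj in fastforce)
  moreover have "compact (sphere 0 1 :: 'a set)" "sphere 0 1 \<noteq> ({} :: 'a set)"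
    by auto
  ultimately obtain v where v: "norm v = 1" and vmax: "\<And>w. norm w = 1 \<Longrightarrow> R w \<le> R v"
    using continuous_attains_sup[of "sphere (0::'a) 1" R] by auto
  have R_scale: "R (c *\<^sub>R w) = R w" if "c \<noteq> 0" for c w
    using that by (simp add: R_def scaleR power_mult_distrib) (simp add: power2_eq_square)
  have max: "R w \<le> R v" if "w \<noteq> 0" for w
    using vmax[of "(1 / norm w) *\<^sub>R w"] R_scale[of "1 / norm w" w] that by simp
  define m where "m = R v"
  have "w0 \<noteq> 0" using pos by auto
  then have "A w0 \<noteq> 0" using inj by blast
  then have "R w0 > 0" using pos by (simp add: R_def)
  with max[OF \<open>w0 \<noteq> 0\<close>] have m: "m > 0" by (simp add: m_def)
  have B: "w \<bullet> A w \<le> m * (norm (A w))\<^sup>2" for w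
  proof (cases "w = 0")
    case False
    then have "A w \<noteq> 0" using inj by blast
    with max[OF False] show ?thesis by (simp add: m_def R_def field_simps)
  qed (simp add: zero)
  have "A v \<noteq> 0" using v inj by force
  then have Bv: "v \<bullet> A v = m * (norm (A v))\<^sup>2"
    by (simp add: m_def R_def)
  have "2 * (z \<bullet> (m *\<^sub>R A (A v) - A v)) = 0" for z
  proof (rule nonneg_quadratic_linear_coeff)
    fix t :: real
    have "0 \<le> m * (norm (A (v + t *\<^sub>R z)))\<^sup>2 - (v + t *\<^sub>R z) \<bullet> A (v + t *\<^sub>R z)"
      using B[of "v + t *\<^sub>R z"] by linarith
    also have "\<dots> = t * (2 * (z \<bullet> (m *\<^sub>R A (A v) - A v))) + t\<^sup>2 * (m * (norm (A z))\<^sup>2 - z \<bullet> A z)"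
    proof -
      have "v \<bullet> A z = z \<bullet> A v"
        using sym[of v z] by (simp add: inner_commute)
      then have "(v + t *\<^sub>R z) \<bullet> A (v + t *\<^sub>R z) = v \<bullet> A v + 2 * t * (z \<bullet> A v) + t\<^sup>2 * (z \<bullet> A z)"
        by (simp add: add scaleR inner_add_left inner_add_right power2_eq_square distrib_left)
      moreover have "(norm (A (v + t *\<^sub>R z)))\<^sup>2
          = (norm (A v))\<^sup>2 + 2 * t * (z \<bullet> A (A v)) + t\<^sup>2 * (norm (A z))\<^sup>2"
        using sym[of z "A v"] inner_commute[of "A v" "A z"] unfolding power2_norm_eq_inner
        by (simp add: add scaleR inner_add_left inner_add_right power2_eq_square distrib_left)
      ultimately show ?thesis
        using Bv by (simp add: inner_diff_right algebra_simps)
    qed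
    finally show "0 \<le> t * (2 * (z \<bullet> (m *\<^sub>R A (A v) - A v))) + t\<^sup>2 * (m * (norm (A z))\<^sup>2 - z \<bullet> A z)" .
  qed
  then have "A (m *\<^sub>R A v - v) = 0"
    by (metis diff scaleR inner_eq_zero_iff mult_eq_0_iff zero_neq_numeral)
  then have "m *\<^sub>R A v = v"
    using inj[of "m *\<^sub>R A v - v"] by simp
  moreover have "(1 / m) *\<^sub>R (m *\<^sub>R A v) = A v"
    using m by simp
  ultimately have "A v = (1 / m) *\<^sub>R v"
    by metis
  moreover have "(1 / m) * (w \<bullet> A w) \<le> (norm (A w))\<^sup>2" for w
    using B[of w] m by (simp add: field_simps)
  ultimately show thesis
    by (intro that[of "1 / m" v]) (use m v in auto)
qed

text \<open>Testing the bound on an eigenvector for an eigenvalue \<open>c > 0\<close> gives \<open>l * c \<le> c\<^sup>2\<close>, so \<open>l \<le> c\<close>.\<close>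
lemma least_pos_eigenvalueI:
  fixes H :: "real^'n^'n"
  assumes l: "l > 0" and v: "v \<noteq> 0" "H *v v = l *\<^sub>R v"
    and bound: "\<And>w. l * (w \<bullet> (H *v w)) \<le> (norm (H *v w))\<^sup>2"
  shows "least_pos_eigenvalue H = l"
  unfolding least_pos_eigenvalue_def
proof (rule Least_equality)
  show "l > 0 \<and> eigenvalue H l"
    using l v by (auto simp: eigenvalue_def)
  fix c assume c: "c > 0 \<and> eigenvalue H c"
  then obtain w where w: "w \<noteq> 0" "H *v w = c *\<^sub>R w"
    by (auto simp: eigenvalue_def)
  have "l * (c * (norm w)\<^sup>2) \<le> c * (c * (norm w)\<^sup>2)"
    using bound[of w] by (simp add: w(2) power_mult_distrib power2_norm_eq_inner power2_eq_square[of c] mult.assoc)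
  with c w(1) show "l \<le> c"
    by simp
qed

section \<open>Blowing up at a critical point\<close>

lemma sequence_avoiding:
  fixes a :: "'a::metric_space"
  assumes "\<not> (\<forall>\<^sub>F x in nhds a. P x)"
  obtains X where "X \<longlonglongrightarrow> a" "\<And>n::nat. \<not> P (X n)"
proof -
  have "\<exists>x. dist x a < inverse (real (Suc n)) \<and> \<not> P x" for n
    using assms by (auto simp: eventually_nhds_metric dest!: spec[of _ "inverse (real (Suc n))"])
  then obtain X where X: "\<And>n. dist (X n) a < inverse (real (Suc n))" "\<And>n. \<not> P (X n)"
    by metis
  have "(\<lambda>n. dist (X n) a) \<longlonglongrightarrow> 0"
    by (rule tendsto_sandwich[OF _ _ tendsto_const LIMSEQ_inverse_real_of_nat])
      (intro always_eventually allI less_imp_le[OF X(1)] zero_le_dist)+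
  then have "X \<longlonglongrightarrow> a"
    by (rule tendsto_dist_iff[THEN iffD2])
  with X(2) that show thesis by blast
qed

text \<open>A remainder of order \<open>o(norm (x - a) ^ p)\<close> stays negligible at the scale \<open>s k ^ p\<close>, because
  \<open>norm (X k - a) / s k\<close> converges. Choosing the scales freely covers both normalised displacements and
  points on a fixed ray.\<close>
lemma rescaled_remainder_tendsto_zero:
  fixes R :: "'a::real_normed_vector \<Rightarrow> 'b::real_normed_vector"
  assumes R: "\<And>e. e > 0 \<Longrightarrow> \<forall>\<^sub>F x in nhds a. norm (R x) \<le> e * norm (x - a) ^ p"
    and p: "p > 0"
    and X: "X \<longlonglongrightarrow> a" and s: "\<And>k. s k > 0" and dir: "(\<lambda>k. (X k - a) /\<^sub>R s k) \<longlonglongrightarrow> u"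
  shows "(\<lambda>k. R (X k) /\<^sub>R s k ^ p) \<longlonglongrightarrow> 0"
  unfolding tendsto_iff
proof safe
  fix e :: real assume e: "e > 0"
  define e' where "e' = e / (norm u + 1) ^ p"
  have "norm u + 1 > 0"
    using norm_ge_zero[of u] by linarith
  with e have e': "e' > 0" "e' * (norm u + 1) ^ p = e"
    by (auto simp: e'_def)
  have "\<forall>\<^sub>F k in sequentially. norm ((X k - a) /\<^sub>R s k) < norm u + 1"
    by (rule order_tendstoD[OF tendsto_norm[OF dir]]) simp
  moreover have "\<forall>\<^sub>F k in sequentially. norm (R (X k)) \<le> e' * norm (X k - a) ^ p"
    by (rule eventually_compose_filterlim[OF R[OF e'(1)] X])
  ultimately show "\<forall>\<^sub>F k in sequentially. dist (R (X k) /\<^sub>R s k ^ p) 0 < e"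
  proof eventually_elim
    case (elim k)
    have "norm (R (X k) /\<^sub>R s k ^ p) = norm (R (X k)) / s k ^ p"
      using s[of k] by (simp add: field_simps)
    also have "\<dots> \<le> e' * norm (X k - a) ^ p / s k ^ p"
      using elim(2) s[of k] by (intro divide_right_mono) auto
    also have "\<dots> = e' * norm ((X k - a) /\<^sub>R s k) ^ p"
      using s[of k] by (simp add: power_divide divide_inverse_commute power_mult_distrib power_inverse)
    also have "\<dots> < e' * (norm u + 1) ^ p"
      using elim(1) e'(1) p by (intro mult_strict_left_mono power_strict_mono) auto
    finally show ?case
      by (simp add: e'(2) dist_norm)
  qed
qed

text \<open>First-order smoothness on \<open>W\<close> identifies the subdifferentials; second-order information enters through the
  single linear map \<open>A\<close>.\<close>
locale critical_point =
  fixes f :: "'a::euclidean_space \<Rightarrow> ereal" and G A :: "'a \<Rightarrow> 'a" and xb :: 'a and W :: "'a set"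
  assumes open_W: "open W" and xb_in_W: "xb \<in> W"
    and finite_f: "\<And>x. x \<in> W \<Longrightarrow> \<bar>f x\<bar> \<noteq> \<infinity>"
    and gradient: "\<And>x. x \<in> W \<Longrightarrow> GDERIV (\<lambda>y. real_of_ereal (f y)) x :> G x"
    and continuous_gradient: "continuous_on W G"
    and gradient_derivative: "(G has_derivative A) (at xb)"
    and critical: "G xb = 0"
begin

abbreviation F :: "'a \<Rightarrow> real" where
  "F x \<equiv> real_of_ereal (f x)"

lemma f_eq: "x \<in> W \<Longrightarrow> f x = ereal (F x)"
  by (simp add: ereal_real' finite_f)

lemma less_iff: "x \<in> W \<Longrightarrow> f xb < f x \<longleftrightarrow> F xb < F x"
  using f_eq[of x] f_eq[OF xb_in_W] by (metis less_ereal.simps(1))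

lemma diff_eq: "x \<in> W \<Longrightarrow> f x - f xb = ereal (F x - F xb)"
  using f_eq[of x] f_eq[OF xb_in_W] by (metis ereal_minus(1))

lemma limiting_subdiff_eq: "x \<in> W \<Longrightarrow> limiting_subdiff f x = {G x}"
  by (rule limiting_subdiff_smooth[OF open_W _ f_eq gradient continuous_gradient])

lemma near_W: "\<forall>\<^sub>F x in nhds xb. x \<in> W"
  using open_W xb_in_W by (rule eventually_nhds_in_open)

lemma tendsto_F: "(F \<longlongrightarrow> F xb) (nhds xb)"
  using has_derivative_continuous[OF gradient[OF xb_in_W, unfolded gderiv_def]]
  unfolding continuous_at by (rule tendsto_at_iff_tendsto_nhds[THEN iffD1])

lemma continuous_F: "continuous_on W F"
  using gradient unfolding gderiv_def
  by (meson continuous_at_imp_continuous_on has_derivative_continuous)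

lemma linear_A: "linear A" and bounded_linear_A: "bounded_linear A"
  using gradient_derivative has_derivative_linear has_derivative_bounded_linear by blast+

lemma gradient_expansion:
  assumes "e > 0"
  shows "\<forall>\<^sub>F x in nhds xb. norm (G x - A (x - xb)) \<le> e * norm (x - xb)"
  using gradient_derivative assms unfolding has_derivative_at_alt eventually_nhds_metric dist_norm critical
  by simp

text \<open>The mean value theorem, applied to the increment of \<open>F\<close> in the direction \<open>v\<close> as the base point moves along
  \<open>u\<close>, turns the second difference into \<open>s\<close> times the \<open>u\<close>-component of a difference of gradients, which is
  \<open>s *\<^sub>R A v\<close> up to an error of order \<open>e * s\<close>.\<close>
lemma second_difference:
  assumes "e > 0"
  shows "\<forall>\<^sub>F s in at_right 0.
    \<bar>(F (xb + s *\<^sub>R v + s *\<^sub>R u) - F (xb + s *\<^sub>R u) - F (xb + s *\<^sub>R v) + F xb) - s\<^sup>2 * (u \<bullet> A v)\<bar>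
      \<le> s\<^sup>2 * (2 * e * (norm u + norm v)\<^sup>2)"
proof -
  interpret A: linear A by (rule linear_A)
  define C where "C = norm u + norm v"
  have C: "C \<ge> 0" by (simp add: C_def)
  obtain d where d: "d > 0" "\<And>x. dist x xb < d \<Longrightarrow> x \<in> W"
      "\<And>x. dist x xb < d \<Longrightarrow> norm (G x - A (x - xb)) \<le> e * norm (x - xb)"
    using eventually_conj[OF near_W gradient_expansion[OF assms]]
    unfolding eventually_nhds_metric by blast
  have "\<bar>(F (xb + s *\<^sub>R v + s *\<^sub>R u) - F (xb + s *\<^sub>R u) - F (xb + s *\<^sub>R v) + F xb) - s\<^sup>2 * (u \<bullet> A v)\<bar>
      \<le> s\<^sup>2 * (2 * e * C\<^sup>2)" if s: "s > 0" "s * C < d" for s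
  proof -
    define p where "p t = xb + s *\<^sub>R v + t *\<^sub>R u" for t
    define q where "q t = xb + t *\<^sub>R u" for t
    have near: "norm (p t - xb) \<le> s * C" "norm (q t - xb) \<le> s * C" if t: "0 \<le> t" "t \<le> s" for t
    proof -
      have tu: "t * norm u \<le> s * norm u"
        using t by (intro mult_right_mono) auto
      have "norm (p t - xb) \<le> norm (s *\<^sub>R v) + norm (t *\<^sub>R u)"
        unfolding p_def by (metis add.assoc add_diff_cancel_left' norm_triangle_ineq)
      with tu show "norm (p t - xb) \<le> s * C"
        using s t by (simp add: C_def distrib_left)
      have "0 \<le> s * norm v" "norm (q t - xb) = t * norm u"
        using s t by (simp_all add: q_def)
      with tu show "norm (q t - xb) \<le> s * C"
        unfolding C_def distrib_left by linarith
    qed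
    have D: "((\<lambda>t. F (p t) - F (q t)) has_real_derivative u \<bullet> G (p t) - u \<bullet> G (q t)) (at t)"
      if t: "0 \<le> t" "t \<le> s" for t
    proof -
      have "p t \<in> W" "q t \<in> W"
        using near[OF t] s d(2) by (force simp: dist_norm)+
      note grads = this[THEN gradient, unfolded gderiv_def]
      have "(p has_derivative (\<lambda>h. h *\<^sub>R u)) (at t)" "(q has_derivative (\<lambda>h. h *\<^sub>R u)) (at t)"
        unfolding p_def q_def by (auto intro!: derivative_eq_intros)
      from has_derivative_diff[OF has_derivative_compose[OF this(1) grads(1)]
          has_derivative_compose[OF this(2) grads(2)]]
      show ?thesis
        unfolding has_field_derivative_def
        by (rule has_derivative_eq_rhs) (simp add: fun_eq_iff algebra_simps)
    qed
    obtain z where z: "0 < z" "z < s"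
      and mvt: "(F (p s) - F (q s)) - (F (p 0) - F (q 0)) = (s - 0) * (u \<bullet> G (p z) - u \<bullet> G (q z))"
      using MVT2[OF s(1) D] by blast
    define a where "a = G (p z) - A (p z - xb)"
    define b where "b = G (q z) - A (q z - xb)"
    have "norm a \<le> e * norm (p z - xb)" "norm b \<le> e * norm (q z - xb)"
      unfolding a_def b_def using near[of z] z s d(3) by (force simp: dist_norm)+
    then have ab: "norm a \<le> e * (s * C)" "norm b \<le> e * (s * C)"
      using near[of z] z assms by (meson less_imp_le mult_left_mono order_trans)+
    have "u \<bullet> G (p z) - u \<bullet> G (q z) = s * (u \<bullet> A v) + u \<bullet> (a - b)"
      unfolding a_def b_def p_def q_def
      by (simp add: A.add A.diff A.scaleR inner_add_right inner_diff_right)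
    then have "(F (p s) - F (q s)) - (F (p 0) - F (q 0)) - s\<^sup>2 * (u \<bullet> A v) = s * (u \<bullet> (a - b))"
      using mvt by (simp add: power2_eq_square distrib_left)
    also have "\<bar>\<dots>\<bar> \<le> s * (norm u * norm (a - b))"
      using s Cauchy_Schwarz_ineq2[of u "a - b"] by (simp add: abs_mult)
    also have "\<dots> \<le> s * (C * (2 * (e * (s * C))))"
    proof -
      have "norm (a - b) \<le> 2 * (e * (s * C))"
        using norm_triangle_ineq4[of a b] ab by linarith
      moreover have "norm u \<le> C"
        by (simp add: C_def)
      ultimately show ?thesis
        using s C by (intro mult_left_mono mult_mono) auto
    qed
    finally show ?thesis
      by (simp add: p_def q_def power2_eq_square algebra_simps)
  qed
  moreover have "\<forall>\<^sub>F s in at_right 0. s * C < d"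
  proof (rule order_tendstoD)
    show "((\<lambda>s. s * C) \<longlongrightarrow> 0 * C) (at_right 0)"
      by (intro tendsto_intros)
    show "0 * C < d" using d by simp
  qed
  ultimately show ?thesis
    using eventually_at_right_less[of "0::real"] unfolding C_def
    by (auto elim: eventually_elim2)
qed

text \<open>The second difference is symmetric in \<open>u\<close> and \<open>v\<close>, so its two approximations by \<open>s\<^sup>2 * (u \<bullet> A v)\<close> and
  \<open>s\<^sup>2 * (v \<bullet> A u)\<close> must agree to leading order.\<close>
lemma hessian_symmetric: "u \<bullet> A v = A u \<bullet> v"
proof -
  define C where "C = (norm u + norm v)\<^sup>2"
  have "\<bar>u \<bullet> A v - v \<bullet> A u\<bar> \<le> 0 + d" if "d > 0" for d
  proof -
    define e where "e = d / (4 * (C + 1))"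
    have C: "C \<ge> 0" by (simp add: C_def)
    with that have e: "e > 0" by (simp add: e_def)
    have "4 * e * C \<le> d"
      using that C unfolding e_def by (simp add: field_simps)
    obtain s where s: "s > 0"
      "\<bar>(F (xb + s *\<^sub>R v + s *\<^sub>R u) - F (xb + s *\<^sub>R u) - F (xb + s *\<^sub>R v) + F xb) - s\<^sup>2 * (u \<bullet> A v)\<bar> \<le> s\<^sup>2 * (2 * e * C)"
      "\<bar>(F (xb + s *\<^sub>R u + s *\<^sub>R v) - F (xb + s *\<^sub>R v) - F (xb + s *\<^sub>R u) + F xb) - s\<^sup>2 * (v \<bullet> A u)\<bar> \<le> s\<^sup>2 * (2 * e * C)"
      using eventually_happens'[OF trivial_limit_at_right_real, OF eventually_conj[OF
          eventually_at_right_less[of "0::real"] eventually_conj[OF second_difference[OF e, of v u] second_difference[OF e, of u v]]]]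
      by (auto simp: C_def add.commute)
    have swap: "xb + s *\<^sub>R u + s *\<^sub>R v = xb + s *\<^sub>R v + s *\<^sub>R u"
      by (simp add: ac_simps)
    have "\<bar>s\<^sup>2 * (u \<bullet> A v) - s\<^sup>2 * (v \<bullet> A u)\<bar> \<le> s\<^sup>2 * (2 * e * C) + s\<^sup>2 * (2 * e * C)"
      using s(2,3) unfolding swap by linarith
    then have "s\<^sup>2 * \<bar>u \<bullet> A v - v \<bullet> A u\<bar> \<le> s\<^sup>2 * (4 * e * C)"
      unfolding right_diff_distrib[symmetric] abs_mult by (simp add: mult_ac)
    with s(1) have "\<bar>u \<bullet> A v - v \<bullet> A u\<bar> \<le> 4 * e * C"
      by simp
    with \<open>4 * e * C \<le> d\<close> show ?thesis by simp
  qed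
  then have "\<bar>u \<bullet> A v - v \<bullet> A u\<bar> \<le> 0"
    by (rule field_le_epsilon)
  then show ?thesis by (simp add: inner_commute)
qed

text \<open>By symmetry of \<open>A\<close>, subtracting the quadratic term from \<open>F\<close> leaves a function with gradient
  \<open>G y - A (y - xb)\<close>. This is at most \<open>e * norm (x - xb)\<close> in norm on the ball around \<open>xb\<close> through \<open>x\<close>,
  so the mean value inequality applies.\<close>
lemma second_order_expansion:
  assumes "e > 0"
  shows "\<forall>\<^sub>F x in nhds xb. norm (F x - F xb - (x - xb) \<bullet> A (x - xb) / 2) \<le> e * norm (x - xb) ^ 2"
proof -
  obtain d where d: "d > 0" "\<And>x. dist x xb < d \<Longrightarrow> x \<in> W"
      "\<And>x. dist x xb < d \<Longrightarrow> norm (G x - A (x - xb)) \<le> e * norm (x - xb)"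
    using eventually_conj[OF near_W gradient_expansion[OF assms]]
    unfolding eventually_nhds_metric by blast
  have "norm (F x - F xb - (x - xb) \<bullet> A (x - xb) / 2) \<le> e * norm (x - xb) ^ 2" if x: "dist x xb < d" for x
  proof -
    define D where "D = norm (x - xb)"
    define \<phi> where "\<phi> y = F y - (y - xb) \<bullet> A (y - xb) / 2" for y
    have near: "dist y xb < d" "norm (y - xb) \<le> D" if "y \<in> cball xb D" for y
      using that x by (auto simp: D_def dist_norm norm_minus_commute)
    have "norm (\<phi> x - \<phi> xb) \<le> (e * D) * norm (x - xb)"
    proof (rule differentiable_bound[where S = "cball xb D" and f' = "\<lambda>y h. h \<bullet> (G y - A (y - xb))"])
      fix y assume y: "y \<in> cball xb D"
      have "((\<lambda>y. (y - xb) \<bullet> A (y - xb) / 2) has_derivative (\<lambda>h. ((y - xb) \<bullet> A h + h \<bullet> A (y - xb)) / 2)) (at y)"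
        by (auto intro!: derivative_eq_intros bounded_linear.has_derivative[OF bounded_linear_A])
      moreover have "(\<lambda>h. ((y - xb) \<bullet> A h + h \<bullet> A (y - xb)) / 2) = (\<lambda>h. h \<bullet> A (y - xb))"
        by (simp add: hessian_symmetric inner_commute)
      ultimately have "((\<lambda>y. (y - xb) \<bullet> A (y - xb) / 2) has_derivative (\<lambda>h. h \<bullet> A (y - xb))) (at y)"
        by simp
      from has_derivative_diff[OF gradient[OF d(2)[OF near(1)[OF y]], unfolded gderiv_def] this]
      have "(\<phi> has_derivative (\<lambda>h. h \<bullet> (G y - A (y - xb)))) (at y)"
        unfolding \<phi>_def by (simp add: inner_diff_right)
      then show "(\<phi> has_derivative (\<lambda>h. h \<bullet> (G y - A (y - xb)))) (at y within cball xb D)"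
        by (rule has_derivative_at_withinI)
      have "norm (G y - A (y - xb)) \<le> e * D"
        using d(3)[OF near(1)[OF y]] near(2)[OF y] assms by (meson less_imp_le mult_left_mono order_trans)
      then show "onorm (\<lambda>h. h \<bullet> (G y - A (y - xb))) \<le> e * D"
        by (intro onorm_le) (metis Cauchy_Schwarz_ineq2 mult.commute mult_left_mono norm_ge_zero order_trans real_norm_def)
    qed (auto simp: D_def dist_norm norm_minus_commute)
    then show ?thesis
      using linear_0[OF linear_A] by (simp add: \<phi>_def D_def power2_eq_square algebra_simps)
  qed
  with d(1) show ?thesis
    unfolding eventually_nhds_metric by blast
qed

text \<open>Both expansions are divided by the matching power of the scale, which makes their remainders vanish and
  their leading terms converge.\<close>
lemma blow_up:
  assumes X: "X \<longlonglongrightarrow> xb" and s: "\<And>k. s k > 0" and dir: "(\<lambda>k. (X k - xb) /\<^sub>R s k) \<longlonglongrightarrow> u"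
  shows blow_up_gradient: "(\<lambda>k. G (X k) /\<^sub>R s k) \<longlonglongrightarrow> A u"
    and blow_up_value: "(\<lambda>k. (F (X k) - F xb) / (s k)\<^sup>2) \<longlonglongrightarrow> u \<bullet> A u / 2"
proof -
  interpret A: linear A by (rule linear_A)
  have lim_A: "(\<lambda>k. A ((X k - xb) /\<^sub>R s k)) \<longlonglongrightarrow> A u"
    using bounded_linear.tendsto[OF bounded_linear_A dir] .
  have "(\<lambda>k. (G (X k) - A (X k - xb)) /\<^sub>R s k ^ 1) \<longlonglongrightarrow> 0"
    by (rule rescaled_remainder_tendsto_zero[OF _ _ X s dir]) (use gradient_expansion in auto)
  from tendsto_add[OF this lim_A] show "(\<lambda>k. G (X k) /\<^sub>R s k) \<longlonglongrightarrow> A u"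
    by (simp add: A.scaleR A.diff scaleR_diff_right)
  have "(\<lambda>k. (F (X k) - F xb - (X k - xb) \<bullet> A (X k - xb) / 2) /\<^sub>R s k ^ 2) \<longlonglongrightarrow> 0"
    by (rule rescaled_remainder_tendsto_zero[OF second_order_expansion _ X s dir]) auto
  from tendsto_add[OF this tendsto_divide[OF tendsto_inner[OF dir lim_A] tendsto_const[of 2]]]
  have "(\<lambda>k. (F (X k) - F xb - (X k - xb) \<bullet> A (X k - xb) / 2) /\<^sub>R (s k)\<^sup>2
      + ((X k - xb) /\<^sub>R s k) \<bullet> (A (X k - xb) /\<^sub>R s k) / 2) \<longlonglongrightarrow> u \<bullet> A u / 2"
    by (simp only: A.scaleR) simp
  moreover have "(c - v \<bullet> w / 2) /\<^sub>R t\<^sup>2 + (v /\<^sub>R t) \<bullet> (w /\<^sub>R t) / 2 = c / t\<^sup>2"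
    for c t :: real and v w :: 'a
    by (cases "t = 0") (simp_all add: field_simps power2_eq_square)
  ultimately show "(\<lambda>k. (F (X k) - F xb) / (s k)\<^sup>2) \<longlonglongrightarrow> u \<bullet> A u / 2"
    by (simp only:)
qed

text \<open>Normalised displacements lie on the compact unit sphere; the sign of \<open>u \<bullet> A u\<close> is inherited from
  \<open>F (X k) - F xb > 0\<close>.\<close>
lemma ascent_subsequence:
  assumes X: "X \<longlonglongrightarrow> xb" and above: "\<And>k. f xb < f (X k)"
  obtains r :: "nat \<Rightarrow> nat" and s u where "strict_mono r" "norm u = 1" "\<And>k. s k > 0"
    "(\<lambda>k. G (X (r k)) /\<^sub>R s k) \<longlonglongrightarrow> A u"
    "(\<lambda>k. (F (X (r k)) - F xb) / (s k)\<^sup>2) \<longlonglongrightarrow> u \<bullet> A u / 2"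
    "u \<bullet> A u \<ge> 0"
proof -
  define n where "n k = norm (X k - xb)" for k
  have n: "n k > 0" for k
    using above[of k] by (auto simp: n_def)
  have dirs: "(X k - xb) /\<^sub>R n k \<in> sphere 0 1" for k
    using n[of k] by (simp add: n_def)
  obtain u r where u: "u \<in> sphere 0 1" and r: "strict_mono r"
    and dir: "((\<lambda>k. (X k - xb) /\<^sub>R n k) \<circ> r) \<longlonglongrightarrow> u"
    by (rule seq_compactE[OF compact_imp_seq_compact[OF compact_sphere], of "\<lambda>k. (X k - xb) /\<^sub>R n k" 0 1])
      (use dirs in auto)
  have Xr: "(\<lambda>k. X (r k)) \<longlonglongrightarrow> xb"
    using LIMSEQ_subseq_LIMSEQ[OF X r] by (simp add: o_def)
  have dir': "(\<lambda>k. (X (r k) - xb) /\<^sub>R n (r k)) \<longlonglongrightarrow> u"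
    using dir by (simp add: o_def)
  note lims = blow_up[OF Xr n dir']
  have "\<forall>\<^sub>F k in sequentially. X (r k) \<in> W"
    by (rule eventually_compose_filterlim[OF near_W Xr])
  then have "\<forall>\<^sub>F k in sequentially. 0 \<le> (F (X (r k)) - F xb) / (n (r k))\<^sup>2"
    by eventually_elim (intro divide_nonneg_nonneg zero_le_power2, metis above less_iff diff_ge_0_iff_ge less_imp_le)
  from tendsto_lowerbound[OF lims(2) this sequentially_bot] have "u \<bullet> A u \<ge> 0"
    by simp
  with that[OF r _ n lims] u show thesis by simp
qed

section \<open>The Kurdyka--Lojasiewicz property at a critical point\<close>

text \<open>Near \<open>xb\<close> the distance from 0 to the limiting subdifferential is \<open>norm (G x)\<close>. Since \<open>F\<close> is continuous at
  \<open>xb\<close>, the upper bound on the values of \<open>f\<close> is no further restriction there; this and the converse below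
  reduce the KL inequality to one about \<open>F\<close> and \<open>G\<close>.\<close>

lemma KL_modulusI:
  assumes \<theta>: "0 \<le> \<theta>" "\<theta> < 1" and \<mu>: "\<mu> > 0"
    and ev: "\<forall>\<^sub>F x in nhds xb. f xb < f x \<longrightarrow> \<mu> / (1 - \<theta>) * (F x - F xb) powr \<theta> \<le> norm (G x)"
  shows "KL_modulus f xb \<theta> \<mu>"
proof -
  obtain d where d: "d > 0" "\<And>x. dist x xb < d \<Longrightarrow> x \<in> W"
      "\<And>x. dist x xb < d \<Longrightarrow> f xb < f x \<Longrightarrow> \<mu> / (1 - \<theta>) * (F x - F xb) powr \<theta> \<le> norm (G x)"
    using eventually_conj[OF near_W ev] unfolding eventually_nhds_metric by blast
  have "ereal (\<mu> / (1 - \<theta>) * real_of_ereal (f x - f xb) powr \<theta>) \<le> edist 0 (limiting_subdiff f x)"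
    if x: "norm (x - xb) \<le> d / 2" "f xb < f x" for x
  proof -
    have "dist x xb < d"
      using x(1) d(1) by (simp add: dist_norm)
    with d x(2) show ?thesis
      by (simp add: limiting_subdiff_eq edist_zero_singleton diff_eq)
  qed
  with \<theta> \<mu> d(1) finite_f[OF xb_in_W] show ?thesis
    unfolding KL_modulus_def by (intro conjI exI[of _ "d / 2"] exI[of _ "\<infinity>"]) auto
qed

lemma KL_modulusD:
  assumes "KL_modulus f xb \<theta> \<mu>"
  shows "\<forall>\<^sub>F x in nhds xb. f xb < f x \<longrightarrow> \<mu> / (1 - \<theta>) * (F x - F xb) powr \<theta> \<le> norm (G x)"
proof -
  obtain \<epsilon> \<nu> where \<epsilon>: "\<epsilon> > 0" and \<nu>: "\<nu> > 0"
    and KL: "\<And>x. norm (x - xb) \<le> \<epsilon> \<Longrightarrow> f xb < f x \<Longrightarrow> f x < f xb + \<nu> \<Longrightarrow>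
      ereal (\<mu> / (1 - \<theta>) * real_of_ereal (f x - f xb) powr \<theta>) \<le> edist 0 (limiting_subdiff f x)"
    using assms unfolding KL_modulus_def by blast
  have "\<forall>\<^sub>F x in nhds xb. dist x xb < \<epsilon>"
    using \<epsilon> by (auto simp: eventually_nhds_metric)
  moreover have "\<forall>\<^sub>F x in nhds xb. ereal (F x) < f xb + \<nu>"
  proof (rule order_tendstoD)
    show "((\<lambda>x. ereal (F x)) \<longlongrightarrow> ereal (F xb)) (nhds xb)"
      by (rule tendsto_ereal[OF tendsto_F])
    show "ereal (F xb) < f xb + \<nu>"
      using \<nu> finite_f[OF xb_in_W] by (cases \<nu>; cases "f xb") auto
  qed
  ultimately show ?thesis
    using near_W
  proof eventually_elim
    case (elim x)
    then have "norm (x - xb) \<le> \<epsilon>" "f x < f xb + \<nu>"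
      using f_eq[OF elim(3)] by (simp add: dist_norm, metis)
    with KL[of x] elim(3) show ?case
      by (simp add: limiting_subdiff_eq edist_zero_singleton diff_eq)
  qed
qed

lemma ascent_path:
  assumes w: "w \<bullet> A w > 0"
  obtains X :: "nat \<Rightarrow> 'a" and s where "X \<longlonglongrightarrow> xb" "\<And>k. s k > 0" "s \<longlonglongrightarrow> 0"
    "(\<lambda>k. (X k - xb) /\<^sub>R s k) \<longlonglongrightarrow> w" "\<And>k. X k \<in> W" "\<And>k. f xb < f (X k)"
proof -
  define s where "s k = inverse (real (Suc k))" for k
  define X where "X k = xb + s k *\<^sub>R w" for k
  have s: "s k > 0" for k
    by (simp add: s_def)
  have s0: "s \<longlonglongrightarrow> 0"
    unfolding s_def by (rule LIMSEQ_inverse_real_of_nat)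
  have "X \<longlonglongrightarrow> xb + 0 *\<^sub>R w"
    unfolding X_def by (intro tendsto_intros s0)
  then have X: "X \<longlonglongrightarrow> xb"
    by simp
  have "(X k - xb) /\<^sub>R s k = w" for k
    using s[of k] by (simp add: X_def)
  then have dir: "(\<lambda>k. (X k - xb) /\<^sub>R s k) \<longlonglongrightarrow> w"
    by simp
  have "\<forall>\<^sub>F k in sequentially. 0 < (F (X k) - F xb) / (s k)\<^sup>2"
    by (rule order_tendstoD[OF blow_up_value[OF X s dir]]) (use w in simp)
  moreover have "\<forall>\<^sub>F k in sequentially. X k \<in> W"
    by (rule eventually_compose_filterlim[OF near_W X])
  ultimately have "\<forall>\<^sub>F k in sequentially. X k \<in> W \<and> f xb < f (X k)"
    by eventually_elim (use s in \<open>auto simp: less_iff zero_less_divide_iff\<close>)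
  then obtain N where N: "\<And>k. k \<ge> N \<Longrightarrow> X k \<in> W \<and> f xb < f (X k)"
    by (auto simp: eventually_sequentially)
  \<comment> \<open>The shift by \<open>N\<close> makes the eventual properties hold at every index.\<close>
  show thesis
  proof (rule that)
    show "(\<lambda>k. X (k + N)) \<longlonglongrightarrow> xb" "(\<lambda>k. s (k + N)) \<longlonglongrightarrow> 0"
      "(\<lambda>k. (X (k + N) - xb) /\<^sub>R s (k + N)) \<longlonglongrightarrow> w"
      using LIMSEQ_ignore_initial_segment[OF X] LIMSEQ_ignore_initial_segment[OF s0]
        LIMSEQ_ignore_initial_segment[OF dir] by blast+
  qed (use s N in auto)
qed

text \<open>Dividing the KL inequality along \<open>xb + s k *\<^sub>R w\<close> by \<open>s k powr (2 * \<theta>)\<close> gives a limit on the left. On the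
  right a factor \<open>s k powr (1 - 2 * \<theta>)\<close> remains, which is 1 for \<open>\<theta> = 1/2\<close> and tends to 0 for smaller
  \<open>\<theta>\<close>. The same lemma therefore limits the modulus for 1/2 and excludes all smaller exponents.\<close>
lemma KL_modulus_bound:
  assumes KL: "KL_modulus f xb \<theta> \<mu>" and \<theta>: "\<theta> \<le> 1/2" and w: "w \<bullet> A w > 0"
  shows "\<mu> / (1 - \<theta>) * (w \<bullet> A w / 2) powr \<theta> \<le> (if \<theta> = 1/2 then norm (A w) else 0)"
proof -
  define c where "c = \<mu> / (1 - \<theta>)"
  obtain X :: "nat \<Rightarrow> 'a" and s where X: "X \<longlonglongrightarrow> xb" and s: "\<And>k. s k > 0" and s0: "s \<longlonglongrightarrow> 0"
    and dir: "(\<lambda>k. (X k - xb) /\<^sub>R s k) \<longlonglongrightarrow> w" and XW: "\<And>k. X k \<in> W" and above: "\<And>k. f xb < f (X k)"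
    by (rule ascent_path[OF w]) blast
  note lims = blow_up_gradient[OF X s dir] blow_up_value[OF X s dir]
  have left: "(\<lambda>k. c * ((F (X k) - F xb) / (s k)\<^sup>2) powr \<theta>) \<longlonglongrightarrow> c * (w \<bullet> A w / 2) powr \<theta>"
    using w by (intro tendsto_mult tendsto_const tendsto_powr lims(2)) simp
  have right: "(\<lambda>k. s k powr (1 - 2 * \<theta>) * norm (G (X k) /\<^sub>R s k))
      \<longlonglongrightarrow> (if \<theta> = 1/2 then norm (A w) else 0)"
  proof (cases "\<theta> = 1/2")
    case True
    have "s k powr (1 - 2 * \<theta>) = 1" for k
      unfolding True using s[of k] by simp
    with tendsto_norm[OF lims(1)] True show ?thesis
      by simp
  next
    case False
    have "(\<lambda>k. s k powr (1 - 2 * \<theta>)) \<longlonglongrightarrow> 0"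
      by (rule tendsto_zero_powrI[OF s0 tendsto_const]) (use s \<theta> False in \<open>auto simp: less_imp_le\<close>)
    from tendsto_mult[OF this tendsto_norm[OF lims(1)]] False show ?thesis
      by simp
  qed
  have "\<forall>\<^sub>F k in sequentially. c * ((F (X k) - F xb) / (s k)\<^sup>2) powr \<theta>
      \<le> s k powr (1 - 2 * \<theta>) * norm (G (X k) /\<^sub>R s k)"
    using eventually_compose_filterlim[OF KL_modulusD[OF KL] X]
  proof eventually_elim
    case (elim k)
    define t where "t = s k powr (2 * \<theta>)"
    have t: "t > 0"
      using s[of k] by (simp add: t_def)
    have "F xb < F (X k)"
      using less_iff[OF XW] above by blast
    then have "((F (X k) - F xb) / (s k)\<^sup>2) powr \<theta> = (F (X k) - F xb) powr \<theta> / t"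
      using s[of k] by (simp add: t_def powr_divide powr_powr flip: powr_numeral)
    moreover have "s k powr (1 - 2 * \<theta>) * norm (G (X k) /\<^sub>R s k) = norm (G (X k)) / t"
      using s[of k] by (simp add: t_def powr_diff field_simps)
    moreover have "c * (F (X k) - F xb) powr \<theta> / t \<le> norm (G (X k)) / t"
      using elim above t by (intro divide_right_mono) (auto simp: c_def)
    ultimately show ?case
      by simp
  qed
  from tendsto_le[OF sequentially_bot right left this] show ?thesis
    by (simp only: c_def)
qed

text \<open>If the inequality failed arbitrarily close to \<open>xb\<close>, a limit direction \<open>u\<close> would satisfy
  \<open>(norm (A u))\<^sup>2 \<le> 2 * \<mu>\<^sup>2 * (u \<bullet> A u)\<close>, which for \<open>2 * \<mu>\<^sup>2 < l\<close> and \<open>A u \<noteq> 0\<close> contradicts the bound.\<close>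
lemma KL_modulus_half:
  assumes l: "l > 0" and bound: "\<And>w. l * (w \<bullet> A w) \<le> (norm (A w))\<^sup>2"
    and inj: "\<And>v. A v = 0 \<Longrightarrow> v = 0" and \<mu>: "\<mu> > 0" "2 * \<mu>\<^sup>2 < l"
  shows "KL_modulus f xb (1/2) \<mu>"
proof (rule KL_modulusI)
  show "\<forall>\<^sub>F x in nhds xb. f xb < f x \<longrightarrow> \<mu> / (1 - 1/2) * (F x - F xb) powr (1/2) \<le> norm (G x)"
  proof (rule ccontr)
    assume "\<not> ?thesis"
    then obtain X where X: "X \<longlonglongrightarrow> xb" and bad:
      "\<And>k::nat. \<not> (f xb < f (X k) \<longrightarrow> \<mu> / (1 - 1/2) * (F (X k) - F xb) powr (1/2) \<le> norm (G (X k)))"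
      by (rule sequence_avoiding) blast
    then have above: "f xb < f (X k)"
      and small: "norm (G (X k)) < 2 * \<mu> * (F (X k) - F xb) powr (1/2)" for k
      by (simp_all add: not_le mult.commute)
    obtain r :: "nat \<Rightarrow> nat" and s u where r: "strict_mono r" and u: "norm u = 1" and s: "\<And>k. s k > 0"
      and lim_G: "(\<lambda>k. G (X (r k)) /\<^sub>R s k) \<longlonglongrightarrow> A u"
      and lim_F: "(\<lambda>k. (F (X (r k)) - F xb) / (s k)\<^sup>2) \<longlonglongrightarrow> u \<bullet> A u / 2"
      and uAu: "u \<bullet> A u \<ge> 0"
      by (rule ascent_subsequence[OF X above]) blast
    have "\<forall>\<^sub>F k in sequentially. X (r k) \<in> W"
      using LIMSEQ_subseq_LIMSEQ[OF X r] by (intro eventually_compose_filterlim[OF near_W]) (simp add: o_def)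
    then have "\<forall>\<^sub>F k in sequentially.
        norm (G (X (r k)) /\<^sub>R s k) \<le> 2 * \<mu> * sqrt ((F (X (r k)) - F xb) / (s k)\<^sup>2)"
    proof eventually_elim
      case (elim k)
      then have "F xb < F (X (r k))"
        using less_iff above by blast
      then have "norm (G (X (r k))) \<le> 2 * \<mu> * sqrt (F (X (r k)) - F xb)"
        using small[of "r k"] by (simp add: powr_half_sqrt)
      then have "norm (G (X (r k))) / s k \<le> 2 * \<mu> * sqrt (F (X (r k)) - F xb) / s k"
        using s[of k] by (intro divide_right_mono) auto
      moreover have "norm (G (X (r k)) /\<^sub>R s k) = norm (G (X (r k))) / s k"
        using s[of k] by (simp add: field_simps)
      moreover have "sqrt ((F (X (r k)) - F xb) / (s k)\<^sup>2) = sqrt (F (X (r k)) - F xb) / s k"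
        using s[of k] by (simp add: real_sqrt_divide)
      ultimately show ?case
        by simp
    qed
    moreover have "(\<lambda>k. 2 * \<mu> * sqrt ((F (X (r k)) - F xb) / (s k)\<^sup>2)) \<longlonglongrightarrow> 2 * \<mu> * sqrt (u \<bullet> A u / 2)"
      by (intro tendsto_intros lim_F)
    ultimately have "norm (A u) \<le> 2 * \<mu> * sqrt (u \<bullet> A u / 2)"
      using tendsto_le[OF sequentially_bot _ tendsto_norm[OF lim_G]] by blast
    then have "(norm (A u))\<^sup>2 \<le> (2 * \<mu> * sqrt (u \<bullet> A u / 2))\<^sup>2"
      by (intro power_mono) auto
    also have "\<dots> = 2 * \<mu>\<^sup>2 * (u \<bullet> A u)"
      using uAu by (simp add: power_mult_distrib)
    finally have "l * (norm (A u))\<^sup>2 \<le> 2 * \<mu>\<^sup>2 * (l * (u \<bullet> A u))"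
      using l by (simp add: mult.left_commute)
    also have "\<dots> \<le> 2 * \<mu>\<^sup>2 * (norm (A u))\<^sup>2"
      by (intro mult_left_mono bound) simp
    also have "\<dots> < l * (norm (A u))\<^sup>2"
      using \<mu>(2) inj[of u] u by (intro mult_strict_right_mono) auto
    finally show False by simp
  qed
qed (use \<mu> in auto)

text \<open>All moduli below \<open>sqrt (l / 2)\<close> are admissible, and the eigenvector \<open>v\<close> is an ascent direction along which
  no larger modulus and no smaller exponent can hold.\<close>
lemma KL_half_exponent:
  assumes l: "l > 0" and v: "v \<noteq> 0" "A v = l *\<^sub>R v"
    and bound: "\<And>w. l * (w \<bullet> A w) \<le> (norm (A w))\<^sup>2" and inj: "\<And>v. A v = 0 \<Longrightarrow> v = 0"
  shows "sharp_KL_exponent f xb (1/2)" and "KL f xb (1/2) = ereal (sqrt (l / 2))"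
proof -
  define m where "m = sqrt (l / 2)"
  have m: "m > 0" "2 * m\<^sup>2 = l"
    using l by (auto simp: m_def)
  have vAv: "v \<bullet> A v = l * (norm v)\<^sup>2" "v \<bullet> A v > 0"
    using l v by (auto simp: power2_norm_eq_inner)
  have modulus: "KL_modulus f xb (1/2) \<mu>" if "0 < \<mu>" "\<mu> < m" for \<mu>
  proof (rule KL_modulus_half[OF l bound inj])
    have "\<mu>\<^sup>2 < m\<^sup>2"
      using that by (intro power_strict_mono) auto
    then show "2 * \<mu>\<^sup>2 < l"
      using m by simp
  qed (use that in auto)
  have "KL_property f xb (1/2)"
    unfolding KL_property_def using modulus[of "m / 2"] m by auto
  moreover have "\<not> KL_property f xb \<theta>" if "0 \<le> \<theta>" "\<theta> < 1/2" for \<theta>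
  proof
    assume "KL_property f xb \<theta>"
    then obtain \<mu> where KL: "KL_modulus f xb \<theta> \<mu>"
      by (auto simp: KL_property_def)
    then have "\<mu> > 0"
      by (simp add: KL_modulus_def)
    with that vAv(2) have "\<mu> / (1 - \<theta>) * (v \<bullet> A v / 2) powr \<theta> > 0"
      by (intro mult_pos_pos divide_pos_pos) auto
    with KL_modulus_bound[OF KL _ vAv(2)] that show False
      by simp
  qed
  ultimately show "sharp_KL_exponent f xb (1/2)"
    by (simp add: sharp_KL_exponent_def)
  have upper: "\<mu> \<le> m" if KL: "KL_modulus f xb (1/2) \<mu>" for \<mu>
  proof -
    have "(v \<bullet> A v / 2) powr (1/2) = sqrt (m\<^sup>2 * (norm v)\<^sup>2)"
      using vAv m by (simp add: powr_half_sqrt)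
    also have "\<dots> = m * norm v"
      using m by (simp add: real_sqrt_mult)
    finally have "2 * \<mu> * (m * norm v) \<le> l * norm v"
      using KL_modulus_bound[OF KL _ vAv(2)] l v(2) by simp
    also have "\<dots> = 2 * m * (m * norm v)"
      using m(2) by (simp add: power2_eq_square)
    finally show ?thesis
      using m v(1) by simp
  qed
  show "KL f xb (1/2) = ereal (sqrt (l / 2))"
    unfolding m_def[symmetric]
  proof (rule antisym)
    show "KL f xb (1/2) \<le> ereal m"
      unfolding KL_def using upper m by (intro Sup_least) auto
    show "ereal m \<le> KL f xb (1/2)"
    proof (rule ccontr)
      assume "\<not> ereal m \<le> KL f xb (1/2)"
      moreover have "0 \<le> KL f xb (1/2)"
        unfolding KL_def by (intro Sup_upper) simp
      ultimately obtain t where t: "KL f xb (1/2) = ereal t" "0 \<le> t" "t < m"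
        by (cases "KL f xb (1/2)") auto
      then have "KL_modulus f xb (1/2) ((t + m) / 2)"
        by (intro modulus) auto
      then have "ereal ((t + m) / 2) \<le> KL f xb (1/2)"
        unfolding KL_def by (intro Sup_upper) blast
      with t show False
        by simp
    qed
  qed
qed

lemma negative_definite_local_max:
  assumes neg: "\<And>w. w \<noteq> 0 \<Longrightarrow> w \<bullet> A w < 0"
  shows "\<forall>\<^sub>F x in nhds xb. \<not> f xb < f x"
proof (rule ccontr)
  assume "\<not> ?thesis"
  then obtain X where X: "X \<longlonglongrightarrow> xb" and above: "\<And>k::nat. \<not> \<not> f xb < f (X k)"
    by (rule sequence_avoiding) blast
  then have "f xb < f (X k)" for k
    by simp
  with X obtain u where "norm u = 1" "u \<bullet> A u \<ge> 0"
    by (rule ascent_subsequence) blast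
  with neg[of u] show False
    by force
qed

lemma KL_zero_exponent:
  assumes max: "\<forall>\<^sub>F x in nhds xb. \<not> f xb < f x"
  shows "KL_property f xb 0" and "outer_limiting_subdiff f xb = {}"
proof -
  have "KL_modulus f xb 0 1"
    by (rule KL_modulusI) (use max in \<open>auto elim: eventually_mono\<close>)
  then show "KL_property f xb 0"
    unfolding KL_property_def by blast
  have False if "X \<longlonglongrightarrow> xb" "\<And>k. f xb < f (X k)" for X :: "nat \<Rightarrow> 'a"
    using eventually_compose_filterlim[OF max that(1)] that(2) by simp
  then show "outer_limiting_subdiff f xb = {}"
    unfolding outer_limiting_subdiff_def by blast
qed

section \<open>The square root of the excess over the critical value\<close>

definition root_excess :: "'a \<Rightarrow> ereal" where
  "root_excess x = esqrt (max (f x - f xb) 0)"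

lemma root_excess_center: "root_excess xb = 0"
  using finite_f[OF xb_in_W] by (simp add: root_excess_def esqrt_def)

lemma root_excess_pos_iff: "0 < root_excess x \<longleftrightarrow> f xb < f x"
proof -
  obtain b where b: "f xb = ereal b"
    using f_eq[OF xb_in_W] by blast
  show ?thesis
    by (cases "f x") (auto simp: root_excess_def esqrt_def b max_def)
qed

lemma root_excess_eq:
  assumes "x \<in> W" "F xb < F x"
  shows "root_excess x = ereal (sqrt (F x - F xb))"
  using assms by (simp add: root_excess_def esqrt_def diff_eq max_def)

text \<open>Strictly above the level of \<open>xb\<close> the square root is differentiable, so the chain rule applies on an open set.\<close>
lemma limiting_subdiff_root_excess:
  assumes x: "x \<in> W" "f xb < f x"
  shows "limiting_subdiff root_excess x = {(1 / (2 * sqrt (F x - F xb))) *\<^sub>R G x}"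
proof (rule limiting_subdiff_smooth[where W = "{y \<in> W. F xb < F y}" and F = "\<lambda>y. sqrt (F y - F xb)"])
  show "open {y \<in> W. F xb < F y}"
    using continuous_open_preimage[OF continuous_F open_W open_greaterThan[of "F xb"]]
    by (simp add: vimage_def Int_def)
  show "x \<in> {y \<in> W. F xb < F y}"
    using x less_iff by simp
  fix y assume y: "y \<in> {y \<in> W. F xb < F y}"
  then show "root_excess y = ereal (sqrt (F y - F xb))"
    by (simp add: root_excess_eq)
  have "GDERIV (\<lambda>y. F y - F xb) y :> G y"
    using GDERIV_diff[OF gradient GDERIV_const] y by simp
  moreover have "DERIV sqrt (F y - F xb) :> inverse (sqrt (F y - F xb)) / 2"
    using y by (intro DERIV_real_sqrt) simp
  ultimately have "GDERIV (\<lambda>y. sqrt (F y - F xb)) y :> (inverse (sqrt (F y - F xb)) / 2) *\<^sub>R G y"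
    by (rule GDERIV_DERIV_compose)
  then show "GDERIV (\<lambda>y. sqrt (F y - F xb)) y :> (1 / (2 * sqrt (F y - F xb))) *\<^sub>R G y"
    by (simp add: field_simps)
next
  have "continuous_on {y \<in> W. F xb < F y} F" "continuous_on {y \<in> W. F xb < F y} G"
    using continuous_F continuous_gradient by (auto elim: continuous_on_subset)
  then show "continuous_on {y \<in> W. F xb < F y} (\<lambda>y. (1 / (2 * sqrt (F y - F xb))) *\<^sub>R G y)"
    by (intro continuous_intros) auto
qed

text \<open>Both inclusions rescale the gradient of the square root as a quotient of \<open>G (X k) /\<^sub>R s k\<close> and
  \<open>2 * sqrt ((F (X k) - F xb) / (s k)\<^sup>2)\<close>. For a given limit \<open>v\<close>, multiplying out first gives
  \<open>(2 * sqrt (u \<bullet> A u / 2)) *\<^sub>R v = A u\<close> without dividing by a possibly vanishing limit; only then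
  \<open>A u \<noteq> 0\<close> shows that \<open>u \<bullet> A u\<close> is positive.\<close>
lemma outer_limiting_subdiff_root_excess:
  assumes inj: "\<And>v. A v = 0 \<Longrightarrow> v = 0"
  shows "outer_limiting_subdiff root_excess xb =
    {(1 / (2 * sqrt (w \<bullet> A w / 2))) *\<^sub>R A w | w. w \<bullet> A w > 0}"
proof (intro equalityI subsetI)
  fix v assume "v \<in> outer_limiting_subdiff root_excess xb"
  then obtain X V where X: "X \<longlonglongrightarrow> xb" and V: "V \<longlonglongrightarrow> v"
    and pos: "\<And>k. root_excess (X k) > root_excess xb"
    and mem: "\<And>k. V k \<in> limiting_subdiff root_excess (X k)"
    unfolding outer_limiting_subdiff_def by blast
  have above: "f xb < f (X k)" for k
    using pos[of k] by (simp add: root_excess_center root_excess_pos_iff)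
  obtain r :: "nat \<Rightarrow> nat" and s u where r: "strict_mono r" and u: "norm u = 1" and s: "\<And>k. s k > 0"
    and lim_G: "(\<lambda>k. G (X (r k)) /\<^sub>R s k) \<longlonglongrightarrow> A u"
    and lim_F: "(\<lambda>k. (F (X (r k)) - F xb) / (s k)\<^sup>2) \<longlonglongrightarrow> u \<bullet> A u / 2"
    and uAu: "u \<bullet> A u \<ge> 0"
    by (rule ascent_subsequence[OF X above]) blast
  have Vr: "(\<lambda>k. V (r k)) \<longlonglongrightarrow> v"
    using LIMSEQ_subseq_LIMSEQ[OF V r] by (simp add: o_def)
  have "\<forall>\<^sub>F k in sequentially. X (r k) \<in> W"
    using LIMSEQ_subseq_LIMSEQ[OF X r] by (intro eventually_compose_filterlim[OF near_W]) (simp add: o_def)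
  then have "\<forall>\<^sub>F k in sequentially.
      (2 * sqrt ((F (X (r k)) - F xb) / (s k)\<^sup>2)) *\<^sub>R V (r k) = G (X (r k)) /\<^sub>R s k"
  proof eventually_elim
    case (elim k)
    then have "V (r k) = (1 / (2 * sqrt (F (X (r k)) - F xb))) *\<^sub>R G (X (r k))"
      using mem[of "r k"] limiting_subdiff_root_excess above by simp
    moreover have "sqrt ((F (X (r k)) - F xb) / (s k)\<^sup>2) = sqrt (F (X (r k)) - F xb) / s k"
      using s[of k] by (simp add: real_sqrt_divide)
    moreover have "F xb < F (X (r k))"
      using elim less_iff above by blast
    ultimately show ?case
      by (simp add: field_simps)
  qed
  moreover have "(\<lambda>k. (2 * sqrt ((F (X (r k)) - F xb) / (s k)\<^sup>2)) *\<^sub>R V (r k))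
      \<longlonglongrightarrow> (2 * sqrt (u \<bullet> A u / 2)) *\<^sub>R v"
    by (intro tendsto_intros lim_F Vr)
  ultimately have "(\<lambda>k. G (X (r k)) /\<^sub>R s k) \<longlonglongrightarrow> (2 * sqrt (u \<bullet> A u / 2)) *\<^sub>R v"
    by (rule Lim_transform_eventually[rotated])
  from LIMSEQ_unique[OF this lim_G] have eq: "(2 * sqrt (u \<bullet> A u / 2)) *\<^sub>R v = A u" .
  have "A u \<noteq> 0"
    using inj[of u] u by auto
  have "u \<bullet> A u \<noteq> 0"
  proof
    assume "u \<bullet> A u = 0"
    with eq have "A u = 0"
      by (metis divide_eq_0_iff mult_zero_right real_sqrt_zero scaleR_zero_left)
    with \<open>A u \<noteq> 0\<close> show False ..
  qed
  with uAu have pos_u: "u \<bullet> A u > 0"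
    by simp
  define c where "c = 2 * sqrt (u \<bullet> A u / 2)"
  have "c *\<^sub>R v = A u" "c \<noteq> 0"
    using eq pos_u by (simp_all add: c_def)
  then have "v = (1 / c) *\<^sub>R A u"
    by (metis divide_self scaleR_one scaleR_scaleR times_divide_eq_left mult_1)
  with pos_u show "v \<in> {(1 / (2 * sqrt (w \<bullet> A w / 2))) *\<^sub>R A w | w. w \<bullet> A w > 0}"
    unfolding c_def by blast
next
  fix v assume "v \<in> {(1 / (2 * sqrt (w \<bullet> A w / 2))) *\<^sub>R A w | w. w \<bullet> A w > 0}"
  then obtain w where w: "w \<bullet> A w > 0" and v: "v = (1 / (2 * sqrt (w \<bullet> A w / 2))) *\<^sub>R A w"
    by blast
  obtain X :: "nat \<Rightarrow> 'a" and s where X: "X \<longlonglongrightarrow> xb" and s: "\<And>k. s k > 0" and s0: "s \<longlonglongrightarrow> 0"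
    and dir: "(\<lambda>k. (X k - xb) /\<^sub>R s k) \<longlonglongrightarrow> w" and XW: "\<And>k. X k \<in> W" and above: "\<And>k. f xb < f (X k)"
    by (rule ascent_path[OF w]) blast
  have FX: "F xb < F (X k)" for k
    using less_iff[OF XW] above by blast
  define V where "V k = (1 / (2 * sqrt (F (X k) - F xb))) *\<^sub>R G (X k)" for k
  have "V k = (1 / (2 * sqrt ((F (X k) - F xb) / (s k)\<^sup>2))) *\<^sub>R (G (X k) /\<^sub>R s k)" for k
    using s[of k] by (simp add: V_def real_sqrt_divide)
  moreover have "(\<lambda>k. (1 / (2 * sqrt ((F (X k) - F xb) / (s k)\<^sup>2))) *\<^sub>R (G (X k) /\<^sub>R s k)) \<longlonglongrightarrow> v"
    unfolding v using w
    by (intro tendsto_intros blow_up_gradient[OF X s dir] blow_up_value[OF X s dir]) auto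
  ultimately have V: "V \<longlonglongrightarrow> v"
    by presburger
  have "(\<lambda>k. sqrt (F (X k) - F xb)) \<longlonglongrightarrow> sqrt (F xb - F xb)"
    by (intro tendsto_intros filterlim_compose[OF tendsto_F X])
  then have "(\<lambda>k. ereal (sqrt (F (X k) - F xb))) \<longlonglongrightarrow> ereal 0"
    by simp
  then have "(\<lambda>k. root_excess (X k)) \<longlonglongrightarrow> root_excess xb"
    by (simp add: root_excess_eq[OF XW FX] root_excess_center zero_ereal_def)
  moreover have "root_excess xb < root_excess (X k)" for k
    by (simp add: root_excess_center root_excess_pos_iff above)
  moreover have "V k \<in> limiting_subdiff root_excess (X k)" for k
    by (simp add: limiting_subdiff_root_excess[OF XW above] V_def)
  ultimately show "v \<in> outer_limiting_subdiff root_excess xb"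
    unfolding outer_limiting_subdiff_def using X V by (auto simp: root_excess_center)
qed

end

section \<open>Nondegenerate critical points\<close>

theorem proposition5p1:
  fixes f :: "real^'n \<Rightarrow> ereal" and xb :: "real^'n"
  defines "H \<equiv> hessian f xb"
    and "g \<equiv> (\<lambda>x. esqrt (max (f x - f xb) 0))"
  assumes "C2_around f xb"
    and "grad f xb = 0"
    and "invertible H"
  shows "(negative_definite H \<longrightarrow>
            KL_property f xb 0 \<and>
            outer_limiting_subdiff f xb = {} \<and>
            \<not> sharp_KL_exponent f xb 0)
       \<and> (positive_definite H \<or> indefinite H \<longrightarrow>
            sharp_KL_exponent f xb (1/2) \<and>
            KL f xb (1/2) = ereal (sqrt (least_pos_eigenvalue H / 2)) \<and>
            outer_limiting_subdiff g xb =
              {(sqrt 2 / 2) *\<^sub>R ((1 / sqrt (w \<bullet> (H *v w))) *\<^sub>R (H *v w)) | w.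
                 w \<bullet> (H *v w) > 0})"
proof -
  obtain U where "open U" "xb \<in> U" "\<forall>x\<in>U. \<bar>f x\<bar> \<noteq> \<infinity>"
    "\<forall>x\<in>U. (\<lambda>y. real_of_ereal (f y)) differentiable (at x)"
    "\<forall>x\<in>U. grad f differentiable (at x)"
    using \<open>C2_around f xb\<close> unfolding C2_around_def by (elim exE conjE) (rule that)
  note U = this(1,2) this(3-5)[rule_format]
  interpret critical_point f "grad f" "(*v) H" xb U
  proof
    show "continuous_on U (grad f)"
      using U(5) by (meson continuous_at_imp_continuous_on differentiable_imp_continuous_within)
    show "(grad f has_derivative (*v) H) (at xb)"
      using U(5)[OF U(2)] unfolding H_def hessian_def jacobian_works .
    show "GDERIV (\<lambda>y. real_of_ereal (f y)) x :> grad f x" if "x \<in> U" for x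
      using gderiv_grad U(4)[OF that] by blast
  qed (use U(1-3) \<open>grad f xb = 0\<close> in auto)
  have inj: "v = 0" if "H *v v = 0" for v
    using \<open>invertible H\<close> that by (metis invertible_def matrix_vector_mul_assoc matrix_vector_mul_lid matrix_vector_mult_0_right)
  have g: "g = root_excess"
    by (simp add: g_def root_excess_def fun_eq_iff)
  have "KL_property f xb 0 \<and> outer_limiting_subdiff f xb = {} \<and> \<not> sharp_KL_exponent f xb 0"
    if "negative_definite H"
    using KL_zero_exponent[OF negative_definite_local_max] that
    by (simp add: negative_definite_def sharp_KL_exponent_def)
  moreover have "sharp_KL_exponent f xb (1/2) \<and> KL f xb (1/2) = ereal (sqrt (least_pos_eigenvalue H / 2))"
    if "positive_definite H \<or> indefinite H"
  proof -
    \<comment> \<open>Positive definiteness yields an ascent direction only from a nonzero vector.\<close>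
    have "axis undefined 1 \<noteq> (0 :: real^'n)"
      by (simp add: axis_eq_0_iff)
    with that obtain w0 where "w0 \<bullet> (H *v w0) > 0"
      unfolding positive_definite_def indefinite_def by blast
    then obtain l v where l: "l > 0" and v: "v \<noteq> 0" "H *v v = l *\<^sub>R v"
      and bound: "\<And>w. l * (w \<bullet> (H *v w)) \<le> (norm (H *v w))\<^sup>2"
      using least_positive_eigenvalue_variational[OF linear_A hessian_symmetric inj] by metis
    show ?thesis
      using KL_half_exponent[OF l v bound inj] least_pos_eigenvalueI[OF l v bound] by simp
  qed
  moreover have "outer_limiting_subdiff g xb =
      {(sqrt 2 / 2) *\<^sub>R ((1 / sqrt (w \<bullet> (H *v w))) *\<^sub>R (H *v w)) | w. w \<bullet> (H *v w) > 0}"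
  proof -
    have "1 / (2 * sqrt (c / 2)) = sqrt 2 / 2 * (1 / sqrt c)" for c :: real
      by (simp add: real_sqrt_divide)
    moreover have "outer_limiting_subdiff root_excess xb =
        {(1 / (2 * sqrt (w \<bullet> (H *v w) / 2))) *\<^sub>R (H *v w) | w. w \<bullet> (H *v w) > 0}"
      by (rule outer_limiting_subdiff_root_excess) (rule inj)
    ultimately show ?thesis
      unfolding g scaleR_scaleR by simp
  qed
  ultimately show ?thesis
    by blast
qed

end
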